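(* Let $\mathbf{P}\subset\mathbb{C}$ be a compact interval or a circle. Let $(A,B) \in C_{n,n}(\mathbf{P}) \times C_{n,m}(\mathbf{P})$ be pointwise reachable and assume that there exists a $v\in \mathbb{C}^m$ with $B(\theta)v\neq0$ for all $\theta\in\mathbf{P}$. Then, for every tuple of continuous functions $\lambda_1, \dots, \lambda_n : \mathbf{P} \to \mathbb{C}$ there is a matrix function $K \in C_{m,n}(\mathbf{P})$ such that $$\sigma ( \mathcal{A}+\mathcal{B}\mathcal{K} ) = \bigcup_{\theta \in \mathbf{P}} \{\lambda_1(\theta),\dots,\lambda_n(\theta)\}.$$
   Context: $C_n(\mathbf{P})$ and $C_{n,m}(\mathbf{P})$ denote the spaces of continuous functions on $\mathbf{P}$ with values in $\mathbb{C}^n$, respectively $\mathbb{C}^{n\times m}$; $C_n(\mathbf{P})$ carries the supremum norm. Here $\mathcal{A}+\mathcal{B}\mathcal{K}$ denotes the bounded multiplication operator on $C_n(\mathbf{P})$ given by $f\mapsto\big(\theta\mapsto (A(\theta)+B(\theta)K(\theta))f(\theta)\big)$, and $\sigma(\cdot)$ is the spectrum of a bounded operator on $C_n(\mathbf{P})$. A pair $(A,B)$ is pointwise reachable if for every $\theta\in\mathbf{P}$ the pair $(A(\theta),B(\theta))$ is reachable, i.e. $\operatorname{rank}(B(\theta),A(\theta)B(\theta),\dots,A(\theta)^{n-1}B(\theta))=n$. *)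

theory Defs
  imports "HOL-Analysis.Analysis"
begin

definition is_compact_interval :: "complex set \<Rightarrow> bool" where
  "is_compact_interval P \<longleftrightarrow> (\<exists>a b. P = closed_segment a b)"

definition is_circle :: "complex set \<Rightarrow> bool" where
  "is_circle P \<longleftrightarrow> (\<exists>c r. r > 0 \<and> P = sphere c r)"

text \<open>The block matrix $(B, AB, \ldots, A^{n-1}B)$: its columns are indexed by pairs $(k,j)$, where
  \<^term>\<open>to_nat_on UNIV\<close> enumerates the finite index type as $0, \ldots, n-1$, and the column
  $(k,j)$ is the $j$-th column of $A^k B$. The iterate \<open>((**) A ^^ k) B\<close> is $A^k B$; the
  power operation \<open>A ^ k\<close> on the vector type would be componentwise.\<close>

definition reachability_matrix ::
  "complex^'n^'n \<Rightarrow> complex^'m^'n \<Rightarrow> complex^('n \<times> 'm)^'n" where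
  "reachability_matrix A B =
     (\<chi> i kj. (((**) A ^^ to_nat_on UNIV (fst kj)) B) $ i $ snd kj)"

definition reachable :: "complex^'n^'n \<Rightarrow> complex^'m^'n \<Rightarrow> bool" where
  "reachable A B \<longleftrightarrow> rank (reachability_matrix A B) = CARD('n)"

definition pointwise_reachable ::
  "complex set \<Rightarrow> (complex \<Rightarrow> complex^'n^'n) \<Rightarrow> (complex \<Rightarrow> complex^'m^'n) \<Rightarrow> bool" where
  "pointwise_reachable P A B \<longleftrightarrow> (\<forall>\<theta>\<in>P. reachable (A \<theta>) (B \<theta>))"

text \<open>Elements of $C_n(P)$ are normalized to be zero outside \<open>P\<close>, so that equality of
  functions is equality on \<open>P\<close>.\<close>

definition cont_space :: "complex set \<Rightarrow> (complex \<Rightarrow> complex^'n) set" where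
  "cont_space P = {f. continuous_on P f \<and> (\<forall>\<theta>. \<theta> \<notin> P \<longrightarrow> f \<theta> = 0)}"

definition sup_norm :: "complex set \<Rightarrow> (complex \<Rightarrow> complex^'n) \<Rightarrow> real" where
  "sup_norm P f = (SUP \<theta>\<in>P. norm (f \<theta>))"

definition bounded_operator ::
  "complex set \<Rightarrow> ((complex \<Rightarrow> complex^'n) \<Rightarrow> (complex \<Rightarrow> complex^'n)) \<Rightarrow> bool" where
  "bounded_operator P T \<longleftrightarrow>
     (\<forall>f\<in>cont_space P. T f \<in> cont_space P) \<and>
     (\<forall>f\<in>cont_space P. \<forall>g\<in>cont_space P. T (\<lambda>\<theta>. f \<theta> + g \<theta>) = (\<lambda>\<theta>. T f \<theta> + T g \<theta>)) \<and>
     (\<forall>c. \<forall>f\<in>cont_space P. T (\<lambda>\<theta>. c *s f \<theta>) = (\<lambda>\<theta>. c *s T f \<theta>)) \<and>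
     (\<exists>M. \<forall>f\<in>cont_space P. sup_norm P (T f) \<le> M * sup_norm P f)"

definition op_spectrum ::
  "complex set \<Rightarrow> ((complex \<Rightarrow> complex^'n) \<Rightarrow> (complex \<Rightarrow> complex^'n)) \<Rightarrow> complex set" where
  "op_spectrum P T = {z. \<not> (\<exists>S. bounded_operator P S \<and>
     (\<forall>f\<in>cont_space P.
        S (\<lambda>\<theta>. z *s f \<theta> - T f \<theta>) = f \<and>
        (\<lambda>\<theta>. z *s S f \<theta> - T (S f) \<theta>) = f))}"

definition mult_operator ::
  "(complex \<Rightarrow> complex^'n^'n) \<Rightarrow> (complex \<Rightarrow> complex^'n) \<Rightarrow> (complex \<Rightarrow> complex^'n)" where
  "mult_operator M f = (\<lambda>\<theta>. M \<theta> *v f \<theta>)"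

end

theory Submission
  imports Defs
begin

text \<open>
  A multiplication operator by a continuous matrix function on a compact set has as its spectrum the
  union of the pointwise eigenvalue sets (\<open>op_spectrum_mult_operator\<close>), so the task is to choose,
  continuously in \<open>\<theta>\<close>, a feedback \<open>K \<theta>\<close> such that \<open>A \<theta> + B \<theta> K \<theta>\<close> has eigenvalues
  \<open>\<lambda>\<^sub>1(\<theta>), \<dots>, \<lambda>\<^sub>n(\<theta>)\<close>.

  The feedback has the form \<open>K = F + v k\<close> with \<open>v\<close> the given vector and \<open>k\<close> a row. Put \<open>b = B v\<close>. If
  \<open>b\<close> is a cyclic vector of \<open>M = A + B F\<close>, that is, if the Krylov vectors \<open>b, M b, \<dots>, M\<^sup>n\<^sup>-\<^sup>1 b\<close> form a
  basis, then Ackermann's formula gives explicitly a row \<open>k\<close> for which \<open>M + b k\<close> has the required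
  eigenvalues (\<open>eigenvalues_ackermann\<close>). The formula only involves polynomials and the inverse of an
  invertible matrix, hence \<open>k\<close> inherits continuity from \<open>M\<close>, \<open>b\<close> and the \<open>\<lambda>\<^sub>i\<close>.

  It remains to choose \<open>F\<close> continuously so that \<open>B \<theta> v\<close> is cyclic for \<open>A \<theta> + B \<theta> F \<theta>\<close> at every
  \<open>\<theta>\<close>. For a fixed \<open>\<theta>\<close> the admissible \<open>F\<close> form the complement of a complex algebraic hypersurface: a
  determinant, polynomial in \<open>F\<close>, must not vanish. This set is nonempty by Heymann's lemma
  (\<open>heymann\<close>), and it is path connected, since two of its points lie on a complex line that meets the
  hypersurface in finitely many points (\<open>path_connected_cyclic_feedbacks\<close>). Moreover the condition is
  open jointly in \<open>\<theta>\<close> and \<open>F\<close>. Over a one-dimensional base, openness and path connected nonempty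
  fibres suffice for a continuous section (\<open>section_over_interval_or_circle\<close>): locally a constant
  works, and two constants are joined by a path inside a single fibre, run through in a very short
  interval.
\<close>

section \<open>Continuous sections over an arc or a circle\<close>

text \<open>The tube lemma for a family of fibres: openness of the total space lets a compact subset of one fibre persist in all nearby fibres.\<close>

lemma compact_subset_fibre_tube:
  fixes W :: "'a::metric_space \<Rightarrow> 'b::topological_space set"
  assumes "openin (top_of_set (P \<times> UNIV)) (Sigma P W)"
    and "t0 \<in> P" "compact C" "C \<subseteq> W t0"
  obtains e where "e > 0" "\<And>t. t \<in> P \<Longrightarrow> dist t t0 < e \<Longrightarrow> C \<subseteq> W t"
proof -
  obtain T where T: "open T" "Sigma P W = (P \<times> UNIV) \<inter> T"
    using assms(1) by (auto simp: openin_open)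
  have "{t0} \<times> C \<subseteq> T"
    using T(2) assms by auto
  from Elementary_Topology.tube_lemma[OF \<open>compact C\<close> \<open>open T\<close> this]
  obtain X where X: "t0 \<in> X" "open X" "X \<times> C \<subseteq> T" by blast
  obtain e where e: "e > 0" "\<And>t. dist t t0 < e \<Longrightarrow> t \<in> X"
    using X by (meson open_dist)
  show thesis
  proof (rule that[OF e(1)])
    fix t assume "t \<in> P" "dist t t0 < e"
    then have "t \<in> X" "t \<in> P" using e by auto
    then have "{t} \<times> C \<subseteq> Sigma P W" using X T by auto
    then show "C \<subseteq> W t" by auto
  qed
qed

text \<open>Prescribing both end values makes the claim additive under concatenation of intervals, so
  by the bisection principle \<open>Bolzano\<close> it is enough to treat short intervals around a given point
  \<open>m\<close>. There a point \<open>F\<close> of the fibre over \<open>m\<close> lies in all fibres; the prescribed end values are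
  connected with \<open>F\<close> by paths inside the two end fibres, and by compactness these paths still lie in
  the fibres very close to the ends.\<close>

lemma section_over_unit_interval:
  fixes W :: "real \<Rightarrow> 'b::real_normed_vector set"
  assumes opn: "openin (top_of_set ({0..1} \<times> UNIV)) (Sigma {0..1} W)"
    and pc: "\<And>t. t \<in> {0..1} \<Longrightarrow> path_connected (W t)"
    and ne: "\<And>t. t \<in> {0..1} \<Longrightarrow> W t \<noteq> {}"
    and xy: "x \<in> W 0" "y \<in> W 1"
  obtains s where "continuous_on {0..1} s" "s 0 = x" "s 1 = y"
    "\<And>t. t \<in> {0..1} \<Longrightarrow> s t \<in> W t"
proof -
  define Q where "Q a b \<longleftrightarrow> (0 \<le> a \<longrightarrow> b \<le> 1 \<longrightarrow> a < b \<longrightarrow>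
      (\<forall>x\<in>W a. \<forall>y\<in>W b. \<exists>s. continuous_on {a..b} s \<and> s a = x \<and> s b = y \<and>
        (\<forall>t\<in>{a..b}. s t \<in> W t)))" for a b :: real
  have "Q 0 1"
  proof (rule Bolzano[of 0 1 Q])
    show "(0::real) \<le> 1" by simp
  next
    fix a b c assume ab: "Q a b" and bc: "Q b c" and le: "a \<le> b" "b \<le> c"
    show "Q a c"
    proof (cases "a = b \<or> b = c")
      case True
      then show ?thesis using ab bc by auto
    next
      case False
      with le have lt: "a < b" "b < c" by auto
      show ?thesis
        unfolding Q_def
      proof (intro impI ballI)
        fix x y assume "0 \<le> a" "c \<le> 1" "a < c" and x: "x \<in> W a" and y: "y \<in> W c"
        then obtain z where z: "z \<in> W b" using ne[of b] lt by auto
        obtain s1 where s1: "continuous_on {a..b} s1" "s1 a = x" "s1 b = z" "\<forall>t\<in>{a..b}. s1 t \<in> W t"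
          using ab[unfolded Q_def] lt x z \<open>0 \<le> a\<close> \<open>c \<le> 1\<close> by fastforce
        obtain s2 where s2: "continuous_on {b..c} s2" "s2 b = z" "s2 c = y" "\<forall>t\<in>{b..c}. s2 t \<in> W t"
          using bc[unfolded Q_def] lt y z \<open>0 \<le> a\<close> \<open>c \<le> 1\<close> by fastforce
        define s where "s = (\<lambda>t. if t \<le> b then s1 t else s2 t)"
        have "continuous_on ({a..b} \<union> {b..c}) s"
          unfolding s_def using s1 s2 by (intro continuous_on_cases) auto
        then have "continuous_on {a..c} s"
          using lt by (simp add: ivl_disj_un_two_touch)
        then show "\<exists>s. continuous_on {a..c} s \<and> s a = x \<and> s c = y \<and> (\<forall>t\<in>{a..c}. s t \<in> W t)"
          using s1 s2 lt by (intro exI[of _ s]) (auto simp: s_def)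
      qed
    qed
  next
    fix m :: real assume m: "0 \<le> m" "m \<le> 1"
    then obtain F where F: "F \<in> W m" using ne[of m] by auto
    obtain d where d: "d > 0" "\<And>t. t \<in> {0..1} \<Longrightarrow> dist t m < d \<Longrightarrow> {F} \<subseteq> W t"
      using compact_subset_fibre_tube[OF opn, of m "{F}"] m F by auto
    have "Q a b" if "a \<le> m" "m \<le> b" "b - a < d" for a b
      unfolding Q_def
    proof (intro impI ballI)
      fix p q assume ab: "0 \<le> a" "b \<le> 1" "a < b" and p: "p \<in> W a" and q: "q \<in> W b"
      have FW: "F \<in> W t" if "t \<in> {a..b}" for t
        using d(2)[of t] that ab \<open>a \<le> m\<close> \<open>m \<le> b\<close> \<open>b - a < d\<close> by (auto simp: dist_real_def)
      obtain g where g: "path g" "path_image g \<subseteq> W a" "pathstart g = p" "pathfinish g = F"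
        using pc[of a] p FW[of a] ab unfolding path_connected_def by fastforce
      obtain h where h: "path h" "path_image h \<subseteq> W b" "pathstart h = q" "pathfinish h = F"
        using pc[of b] q FW[of b] ab unfolding path_connected_def by fastforce
      obtain e1 where e1: "e1 > 0" "\<And>t. t \<in> {0..1} \<Longrightarrow> dist t a < e1 \<Longrightarrow> path_image g \<subseteq> W t"
        using compact_subset_fibre_tube[OF opn, of a "path_image g"] g ab
        by (auto simp: compact_path_image)
      obtain e2 where e2: "e2 > 0" "\<And>t. t \<in> {0..1} \<Longrightarrow> dist t b < e2 \<Longrightarrow> path_image h \<subseteq> W t"
        using compact_subset_fibre_tube[OF opn, of b "path_image h"] h ab
        by (auto simp: compact_path_image)
      define e where "e = min (min e1 e2) (b - a) / 2"
      have e: "e > 0" "e < e1" "e < e2" "2 * e \<le> b - a"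
        using e1(1) e2(1) ab by (auto simp: e_def)
      have g1: "g 1 = F" "g 0 = p" "h 1 = F" "h 0 = q"
        using g h by (auto simp: pathstart_def pathfinish_def)
      have cg: "continuous_on {0..1} g" "continuous_on {0..1} h"
        using g h by (auto simp: path_def)
      \<comment> \<open>Since \<open>2 * e \<le> b - a\<close>, at any time at least one of the first two summands equals \<open>F\<close>.\<close>
      define s where "s = (\<lambda>t. g (min 1 ((t - a) / e)) + h (min 1 ((b - t) / e)) - F)"
      have "continuous_on {a..b} s"
        unfolding s_def
        using e by (intro continuous_intros continuous_on_compose2[OF cg(1)] continuous_on_compose2[OF cg(2)]) auto
      moreover have "s a = p" "s b = q"
        using e ab by (auto simp: s_def g1 min_def field_simps)
      moreover have "s t \<in> W t" if t: "t \<in> {a..b}" for t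
      proof -
        consider "t - a < e" | "b - t < e" | "t - a \<ge> e" "b - t \<ge> e" by linarith
        then show ?thesis
        proof cases
          case 1
          then have "(b - t) / e \<ge> 1" using e by (simp add: field_simps)
          then have "s t = g ((t - a) / e)" using 1 e by (simp add: s_def g1 min_def field_simps)
          also have "\<dots> \<in> path_image g" using 1 e t by (auto simp: path_image_def)
          finally show ?thesis using e1(2)[of t] 1 e t ab by (auto simp: dist_real_def)
        next
          case 2
          then have "(t - a) / e \<ge> 1" using e by (simp add: field_simps)
          then have "s t = h ((b - t) / e)" using 2 e by (simp add: s_def g1 min_def field_simps)
          also have "\<dots> \<in> path_image h" using 2 e t by (auto simp: path_image_def)
          finally show ?thesis using e2(2)[of t] 2 e t ab by (auto simp: dist_real_def)
        next
          case 3
          then have "s t = F" using e by (simp add: s_def g1 min_def field_simps)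
          then show ?thesis using FW t by simp
        qed
      qed
      ultimately show "\<exists>s. continuous_on {a..b} s \<and> s a = p \<and> s b = q \<and> (\<forall>t\<in>{a..b}. s t \<in> W t)"
        by (intro exI[of _ s] conjI ballI)
    qed
    then show "\<exists>d>0. \<forall>a b. a \<le> m \<and> m \<le> b \<and> b - a < d \<longrightarrow> Q a b"
      using d(1) by (intro exI[of _ d]) simp
  qed
  then have "\<forall>x\<in>W 0. \<forall>y\<in>W 1. \<exists>s. continuous_on {0..1} s \<and> s 0 = x \<and> s 1 = y \<and> (\<forall>t\<in>{0..1}. s t \<in> W t)"
    unfolding Q_def by simp
  from bspec[OF bspec[OF this xy(1)] xy(2)] that show thesis by blast
qed

text \<open>A curve that is simple, except possibly for coinciding end points, is a quotient of the unit
  interval. A section over the interval whose end values agree whenever the end points of the curve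
  do descends to the curve.\<close>

lemma section_over_parametrized_curve:
  fixes p :: "real \<Rightarrow> 'a::metric_space" and W :: "'a \<Rightarrow> 'b::real_normed_vector set"
  assumes p: "continuous_on {0..1} p" "p ` {0..1} = P"
    and inj: "\<forall>t\<in>{0..1}. \<forall>u\<in>{0..1}. p t = p u \<longrightarrow> t = u \<or> {t, u} = {0, 1}"
    and opn: "openin (top_of_set (P \<times> UNIV)) (Sigma P W)"
    and pc: "\<forall>t\<in>P. path_connected (W t)"
    and ne: "\<forall>t\<in>P. W t \<noteq> {}"
  shows "\<exists>s. continuous_on P s \<and> (\<forall>t\<in>P. s t \<in> W t)"
proof -
  have pP: "p t \<in> P" if "t \<in> {0..1}" for t using p that by auto
  obtain x where x: "x \<in> W (p 0)" using ne pP[of 0] by auto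
  obtain y where y: "y \<in> W (p 1)" "p 0 = p 1 \<Longrightarrow> y = x"
    using ne pP[of 1] x by (cases "p 0 = p 1") auto
  have "continuous_on ({0..1} \<times> UNIV) (\<lambda>z::real \<times> 'b. (p (fst z), snd z))"
    by (intro continuous_intros continuous_on_compose2[OF p(1)]) auto
  then have "openin (top_of_set ({0..1} \<times> UNIV))
      (({0..1} \<times> UNIV) \<inter> (\<lambda>z::real \<times> 'b. (p (fst z), snd z)) -` Sigma P W)"
    using opn pP by (intro continuous_openin_preimage[where T = "P \<times> UNIV"]) auto
  also have "(({0..1} \<times> UNIV) \<inter> (\<lambda>z::real \<times> 'b. (p (fst z), snd z)) -` Sigma P W)
      = Sigma {0..1} (\<lambda>t. W (p t))"
    using pP by auto
  finally have "openin (top_of_set ({0..1} \<times> UNIV)) (Sigma {0..1} (\<lambda>t. W (p t)))" .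
  then obtain s where s: "continuous_on {0..1} s" "s 0 = x" "s 1 = y" "\<And>t. t \<in> {0..1} \<Longrightarrow> s t \<in> W (p t)"
    using section_over_unit_interval[of "\<lambda>t. W (p t)" x y] x y(1) pc ne pP by metis
  have "s t = s u" if "t \<in> {0..1}" "u \<in> {0..1}" "p t = p u" for t u
    using bspec[OF bspec[OF inj that(1)] that(2)] that(3) y(2) s(2,3) by (auto simp: doubleton_eq_iff)
  moreover have "quotient_map (top_of_set {0..1}) (top_of_set P) p"
  proof (rule T1_Spaces.continuous_imp_quotient_map)
    show "continuous_map (top_of_set {0..1}) (top_of_set P) p"
      using p(1) pP by (simp add: image_subset_iff)
    show "compact_space (top_of_set {0..1::real})"
      by (simp add: compact_space_subtopology)
    show "Hausdorff_space (top_of_set P)"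
      by (rule Hausdorff_space_subtopology[OF Hausdorff_space_euclidean])
    show "p ` topspace (top_of_set {0..1}) = topspace (top_of_set P)"
      using p by simp
  qed
  ultimately obtain f where f: "continuous_map (top_of_set P) euclidean f" "\<And>t. t \<in> {0..1} \<Longrightarrow> f (p t) = s t"
    using quotient_map_lift_exists[of "top_of_set {0..1}" "top_of_set P" p euclidean s] s(1)
    by (metis (no_types, lifting) continuous_map_iff_continuous topspace_euclidean_subtopology)
  have "f t \<in> W t" if "t \<in> P" for t
    using that p(2) f(2) s(4) by auto
  with f(1) show ?thesis by auto
qed

lemma section_over_interval_or_circle:
  fixes W :: "complex \<Rightarrow> 'b::real_normed_vector set"
  assumes P: "is_compact_interval P \<or> is_circle P"
    and opn: "openin (top_of_set (P \<times> UNIV)) (Sigma P W)"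
    and pc: "\<forall>t\<in>P. path_connected (W t)"
    and ne: "\<forall>t\<in>P. W t \<noteq> {}"
  shows "\<exists>s. continuous_on P s \<and> (\<forall>t\<in>P. s t \<in> W t)"
  using P
proof
  assume "is_compact_interval P"
  then obtain a b where ab: "P = closed_segment a b" by (auto simp: is_compact_interval_def)
  show ?thesis
  proof (cases "a = b")
    case True
    then have "P = {a}" using ab by simp
    moreover obtain F where "F \<in> W a" using ne \<open>P = {a}\<close> by auto
    ultimately show ?thesis by (intro exI[of _ "\<lambda>_. F"]) auto
  next
    case False
    then have "inj_on (linepath a b) {0..1}" by (simp add: inj_on_linepath)
    then have inj: "\<forall>t\<in>{0..1}. \<forall>u\<in>{0..1}. linepath a b t = linepath a b u \<longrightarrow> t = u \<or> {t, u} = {0, 1}"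
      by (auto dest: inj_onD)
    have img: "linepath a b ` {0..1} = P" by (simp add: ab linepath_image_01)
    show ?thesis
      by (rule section_over_parametrized_curve[OF continuous_on_linepath img inj opn pc ne])
  qed
next
  assume "is_circle P"
  then obtain c r where cr: "P = sphere c r" "r > 0" by (auto simp: is_circle_def)
  define p where "p = (\<lambda>t::real. c + of_real r * exp (\<i> * of_real (2 * pi * t)))"
  have arg: "Arg2pi (p t - c) = 2 * pi * t" if "0 \<le> t" "t < 1" for t
    by (rule Arg2pi_unique[of r]) (use cr that in \<open>auto simp: p_def\<close>)
  have p01: "p 1 = p 0" by (simp add: p_def mult.commute)
  have img: "p ` {0..1} = P"
  proof
    show "p ` {0..1} \<subseteq> P" using cr by (auto simp: p_def dist_norm norm_mult)
    show "P \<subseteq> p ` {0..1}"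
    proof
      fix z assume "z \<in> P"
      then have "norm (z - c) = r" using cr by (auto simp: dist_norm norm_minus_commute)
      then have "z = p (Arg2pi (z - c) / (2 * pi))"
        using Arg2pi[of "z - c"] by (simp add: p_def is_Arg_def algebra_simps)
      moreover have "Arg2pi (z - c) / (2 * pi) \<in> {0..1}"
        using Arg2pi[of "z - c"] by (auto simp: field_simps)
      ultimately show "z \<in> p ` {0..1}" by blast
    qed
  qed
  have inj: "t = u \<or> {t, u} = {0, 1}" if tu: "t \<in> {0..1}" "u \<in> {0..1}" "p t = p u" for t u
  proof -
    \<comment> \<open>The argument determines the parameter only in the half-open interval.\<close>
    define m where "m x = (if x = 1 then 0 else x)" for x :: real
    have pm: "p (m x) = p x" for x using p01 by (simp add: m_def)
    have "Arg2pi (p x - c) = 2 * pi * m x" if "x \<in> {0..1}" for x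
      unfolding pm[of x, symmetric] by (rule arg) (use that in \<open>auto simp: m_def\<close>)
    from this[OF tu(1)] this[OF tu(2)] have "m t = m u" using tu(3) by simp
    then show ?thesis by (auto simp: m_def split: if_splits)
  qed
  have "continuous_on {0..1} p" unfolding p_def by (intro continuous_intros)
  then show ?thesis
    by (rule section_over_parametrized_curve[OF _ img _ opn pc ne]) (use inj in blast)
qed

section \<open>Pole placement for a single input\<close>

text \<open>Its invertibility expresses that \<open>b\<close> is a cyclic vector of \<open>M\<close>.\<close>

definition krylov_matrix :: "'a::field^'n^'n \<Rightarrow> 'a^'n \<Rightarrow> 'a^'n^'n" where
  "krylov_matrix M b = (\<chi> i k. (((*v) M ^^ to_nat_on UNIV k) b) $ i)"

lemma to_nat_on_UNIV_less: "to_nat_on UNIV (k::'n::finite) < CARD('n)"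
  using to_nat_on_finite[of "UNIV :: 'n set"] by (auto simp: bij_betw_def)

lemma to_nat_on_UNIV_surj:
  assumes "j < CARD('n::finite)"
  obtains k :: "'n::finite" where "to_nat_on UNIV k = j"
  using to_nat_on_finite[of "UNIV :: 'n set"] assms
  by (metis bij_betw_def finite_code imageE lessThan_iff)

lemma krylov_matrix_vector_mult:
  "krylov_matrix M b *v c = (\<Sum>k\<in>UNIV. c $ k *s (((*v) M ^^ to_nat_on UNIV k) b))"
  by (simp add: krylov_matrix_def matrix_mult_sum column_def vec_lambda_eta)

text \<open>The bilinear pairing without conjugation, so that \<open>w v* A\<close> is the adjoint of \<open>A\<close> acting on functionals over any field.\<close>

definition dot :: "'a::comm_semiring_1^'n \<Rightarrow> 'a^'n \<Rightarrow> 'a" where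
  "dot w x = (\<Sum>i\<in>UNIV. w $ i * x $ i)"

lemma dot_add: "dot w (x + y) = dot w x + dot w y"
  by (simp add: dot_def algebra_simps sum.distrib)

lemma dot_scale: "dot w (c *s x) = c * dot w x"
  by (simp add: dot_def algebra_simps sum_distrib_left)

lemma dot_minus: "dot (- w) x = - dot w x" for w :: "'a::comm_ring_1^'n"
  by (simp add: dot_def sum_negf)

lemma dot_vector_matrix_mult: "dot (w v* A) x = dot w (A *v x)"
  unfolding dot_def vector_matrix_mult_def matrix_vector_mult_def
  by (simp add: sum_distrib_left sum_distrib_right mult_ac) (rule sum.swap)

definition outer :: "'a::semiring_1^'n \<Rightarrow> 'a^'m \<Rightarrow> 'a^'m^'n" where
  "outer b k = (\<chi> i j. b $ i * k $ j)"

lemma outer_mult: "outer b k *v x = dot k x *s b" for b :: "'a::comm_semiring_1^'n"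
  by (simp add: vec_eq_iff outer_def matrix_vector_mult_def dot_def sum_distrib_left mult_ac)

text \<open>The polynomial \<open>\<Prod>i<j. (t - l i)\<close> evaluated at \<open>M\<close>. The new factor stands on the right so that
  the functionals \<open>w v* shifted_product M l j\<close> satisfy a two-term recursion by definition.\<close>

fun shifted_product :: "'a::comm_ring_1^'n^'n \<Rightarrow> (nat \<Rightarrow> 'a) \<Rightarrow> nat \<Rightarrow> 'a^'n^'n" where
  "shifted_product M l 0 = mat 1"
| "shifted_product M l (Suc j) = shifted_product M l j ** (M - mat (l j))"

lemma mat_mult_vec: "mat c *v x = c *s x" for x :: "'a::comm_ring_1^'n"
  by (simp add: vec_eq_iff matrix_vector_mult_def mat_def if_distrib if_distribR cong: if_cong)

text \<open>Ackermann's formula without determinants. The functional \<open>w\<close> is dual to the last Krylov vector.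
  The functionals \<open>\<phi> j = w (M - l 0) \<dots> (M - l (j - 1))\<close> for \<open>j < n\<close> form a basis of the dual space,
  because their values on the Krylov vectors form an anti-triangular matrix with ones on the
  antidiagonal. The gain is \<open>-\<phi> n\<close>, which is exactly what makes \<open>\<phi> j\<close> composed with the closed loop
  matrix equal to \<open>l j \<phi> j + \<phi> (j + 1)\<close>, with no second term for \<open>j = n - 1\<close>. An eigenvector \<open>x\<close> for
  \<open>z\<close> is therefore the same as a nonzero solution of \<open>\<phi> (j + 1) x = (z - l j) \<phi> j x\<close> whose
  continuation to \<open>j = n\<close> vanishes, and this exists exactly if \<open>\<Prod>j<n. (z - l j)\<close> is zero.\<close>

lemma eigenvalues_ackermann:
  fixes M :: "'a::field^'n^'n"
  assumes inv: "invertible (krylov_matrix M b)"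
    and w: "\<And>i. i < CARD('n) \<Longrightarrow> dot w (((*v) M ^^ i) b) = (if Suc i = CARD('n) then 1 else 0)"
  shows "(\<exists>x. x \<noteq> 0 \<and> (M + outer b (- (w v* shifted_product M l CARD('n)))) *v x = z *s x)
    \<longleftrightarrow> (\<exists>j<CARD('n). z = l j)"
proof -
  define n where "n = CARD('n)"
  have n0: "n > 0" by (simp add: n_def)
  define N where "N = M + outer b (- (w v* shifted_product M l n))"
  define \<phi> where "\<phi> j x = dot w (shifted_product M l j *v x)" for j x
  have add: "\<phi> j (x + y) = \<phi> j x + \<phi> j y" for j x y
    by (simp add: \<phi>_def matrix_vector_right_distrib dot_add)
  have scale: "\<phi> j (c *s x) = c * \<phi> j x" for j c x
    by (simp add: \<phi>_def vector_scalar_commute dot_scale)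
  have diff: "\<phi> j (x - y) = \<phi> j x - \<phi> j y" for j x y
    using add[of j "x - y" y] by simp
  have zero: "\<phi> j 0 = 0" for j using diff[of j 0 0] by simp
  have sum: "\<phi> j (\<Sum>k\<in>S. f k) = (\<Sum>k\<in>S. \<phi> j (f k))" if "finite S" for j f and S :: "'n set"
    using that by induction (simp_all add: zero add)
  have step: "\<phi> (Suc j) x = \<phi> j (M *v x) - l j * \<phi> j x" for j x
  proof -
    have "\<phi> (Suc j) x = \<phi> j (M *v x - l j *s x)"
      by (simp add: \<phi>_def matrix_vector_mul_assoc[symmetric] matrix_vector_mult_diff_rdistrib mat_mult_vec)
    then show ?thesis by (simp add: diff scale)
  qed
  have tri: "\<phi> j (((*v) M ^^ i) b) = (if Suc (i + j) = n then 1 else 0)" if "i + j < n" for i j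
    using that
  proof (induction j arbitrary: i)
    case 0
    then show ?case using w[of i] by (simp add: \<phi>_def n_def)
  next
    case (Suc j)
    then show ?case using Suc.IH[of "Suc i"] Suc.IH[of i] by (simp add: step)
  qed
  have N: "\<phi> j (N *v x) = (if Suc j = n then 0 else \<phi> (Suc j) x) + l j * \<phi> j x" if "j < n" for j x
  proof -
    have "N *v x = M *v x - \<phi> n x *s b"
      by (simp add: N_def matrix_vector_mult_add_rdistrib outer_mult dot_minus dot_vector_matrix_mult
          \<phi>_def vec_eq_iff)
    then have "\<phi> j (N *v x) = \<phi> (Suc j) x + l j * \<phi> j x - \<phi> n x * \<phi> j b"
      by (simp add: diff scale step)
    then show ?thesis using tri[of 0 j] that by auto
  qed
  have sep: "x = 0" if x: "\<And>j. j < n \<Longrightarrow> \<phi> j x = 0" for x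
  proof -
    obtain c where c: "x = krylov_matrix M b *v c"
      using inv by (metis invertible_eq_bij bij_pointE)
    have "c = 0"
    proof (rule ccontr)
      assume "c \<noteq> 0"
      then have "{k. c $ k \<noteq> 0} \<noteq> {}" by (auto simp: vec_eq_iff)
      then obtain k where "k \<in> {k. c $ k \<noteq> 0}"
        "\<not> (\<exists>k'\<in>{k. c $ k \<noteq> 0}. - int (to_nat_on UNIV k') < - int (to_nat_on UNIV k))"
        using arg_min_if_finite[of "{k. c $ k \<noteq> 0}" "\<lambda>k. - int (to_nat_on UNIV k)"]
        by (meson finite)
      then have k: "c $ k \<noteq> 0" "\<And>k'. c $ k' \<noteq> 0 \<Longrightarrow> to_nat_on UNIV k' \<le> to_nat_on UNIV k"
        by (auto simp: not_less)
      \<comment> \<open>With \<open>k\<close> the last index of a nonzero coefficient, this functional sees only that coefficient.\<close>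
      define j where "j = n - Suc (to_nat_on UNIV k)"
      have kn: "to_nat_on UNIV k < n" using to_nat_on_UNIV_less[of k] by (simp add: n_def)
      have "\<phi> j x = (\<Sum>k'\<in>UNIV. c $ k' * \<phi> j (((*v) M ^^ to_nat_on UNIV k') b))"
        unfolding c krylov_matrix_vector_mult by (simp add: sum scale)
      also have "\<dots> = (\<Sum>k'\<in>UNIV. if k' = k then c $ k else 0)"
      proof (rule sum.cong)
        fix k' :: 'n
        show "c $ k' * \<phi> j (((*v) M ^^ to_nat_on UNIV k') b) = (if k' = k then c $ k else 0)"
        proof (cases "c $ k' = 0")
          case True
          then show ?thesis using k by auto
        next
          case False
          then have le: "to_nat_on UNIV k' \<le> to_nat_on UNIV k" by (rule k)
          have lt: "to_nat_on UNIV k' + j < n" using kn le by (auto simp: j_def)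
          have "Suc (to_nat_on UNIV k' + j) = n \<longleftrightarrow> to_nat_on UNIV k' = to_nat_on UNIV k"
            using kn le unfolding j_def by linarith
          also have "\<dots> \<longleftrightarrow> k' = k"
            by (simp add: countable_finite)
          finally show ?thesis using tri[OF lt] by auto
        qed
      qed simp
      also have "\<dots> = c $ k" by simp
      finally show False using x[of j] k n0 by (simp add: j_def)
    qed
    then show ?thesis using c by simp
  qed
  have interp: "\<exists>x. \<forall>j<n. \<phi> j x = a j" for a
  proof -
    define W where "W = (\<chi> k. w v* shifted_product M l (to_nat_on UNIV k) :: 'a^'n^'n)"
    have W: "(W *v x) $ k = \<phi> (to_nat_on UNIV k) x" for x k
      unfolding \<phi>_def dot_vector_matrix_mult[symmetric]
      by (simp add: W_def matrix_vector_mult_def dot_def)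
    have "x = 0" if "W *v x = 0" for x
    proof (rule sep)
      fix j assume "j < n"
      then have "j < CARD('n)" by (simp add: n_def)
      then obtain k :: 'n where "to_nat_on UNIV k = j" by (rule to_nat_on_UNIV_surj)
      then show "\<phi> j x = 0" using W[of x k] that by simp
    qed
    then have "invertible W"
      by (simp add: invertible_left_inverse matrix_left_invertible_ker)
    then obtain x where x: "W *v x = (\<chi> k. a (to_nat_on UNIV k))"
      by (metis invertible_eq_bij bij_pointE)
    have "\<phi> j x = a j" if "j < n" for j
    proof -
      from that have "j < CARD('n)" by (simp add: n_def)
      then obtain k :: 'n where "to_nat_on UNIV k = j" by (rule to_nat_on_UNIV_surj)
      then show ?thesis using W[of x k] x by simp
    qed
    then show ?thesis by blast
  qed
  have "(\<exists>x. x \<noteq> 0 \<and> N *v x = z *s x) \<longleftrightarrow> (\<exists>j<n. z = l j)"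
  proof
    assume "\<exists>x. x \<noteq> 0 \<and> N *v x = z *s x"
    then obtain x where x: "x \<noteq> 0" "N *v x = z *s x" by blast
    have rec: "(if Suc j = n then 0 else \<phi> (Suc j) x) = (z - l j) * \<phi> j x" if "j < n" for j
      using N[OF that, of x] x scale[of j z x] by (simp add: algebra_simps)
    have pow: "\<phi> j x = (\<Prod>i<j. z - l i) * \<phi> 0 x" if "j < n" for j
      using that
    proof (induction j)
      case (Suc j)
      then show ?case using rec[of j] by simp
    qed simp
    have "\<phi> 0 x \<noteq> 0"
    proof
      assume "\<phi> 0 x = 0"
      then have "\<phi> j x = 0" if "j < n" for j by (subst pow[OF that]) simp
      then show False using sep x(1) by blast
    qed
    moreover have "(\<Prod>i<Suc (n - 1). z - l i) * \<phi> 0 x = 0"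
    proof -
      have "(\<Prod>i<Suc (n - 1). z - l i) * \<phi> 0 x = (z - l (n - 1)) * ((\<Prod>i<n - 1. z - l i) * \<phi> 0 x)"
        by (simp only: prod.lessThan_Suc mult_ac)
      also have "\<dots> = (z - l (n - 1)) * \<phi> (n - 1) x"
        using n0 by (subst pow[of "n - 1"]) simp_all
      also have "\<dots> = 0" using rec[of "n - 1"] n0 by simp
      finally show ?thesis .
    qed
    ultimately have "(\<Prod>i<n. z - l i) = 0" using n0 by simp
    then show "\<exists>j<n. z = l j" by auto
  next
    assume "\<exists>j<n. z = l j"
    then have P0: "(\<Prod>i<n. z - l i) = 0" by auto
    obtain x where x: "\<And>j. j < n \<Longrightarrow> \<phi> j x = (\<Prod>i<j. z - l i)"
      using interp[of "\<lambda>j. \<Prod>i<j. z - l i"] by auto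
    have "N *v x - z *s x = 0"
    proof (rule sep)
      fix j assume j: "j < n"
      have "(if Suc j = n then 0 else \<phi> (Suc j) x) = (\<Prod>i<Suc j. z - l i)"
      proof (cases "Suc j = n")
        case True
        then show ?thesis using P0 by simp
      next
        case False
        then show ?thesis using x[of "Suc j"] j by simp
      qed
      then show "\<phi> j (N *v x - z *s x) = 0"
        using N[OF j, of x] x[OF j] by (simp add: diff scale algebra_simps)
    qed
    moreover have "x \<noteq> 0" using x[of 0] n0 zero by auto
    ultimately show "\<exists>x. x \<noteq> 0 \<and> N *v x = z *s x" by auto
  qed
  then show ?thesis by (simp add: N_def n_def)
qed

section \<open>Heymann's lemma\<close>

text \<open>Reachability in the form that is used below: the rows of the block matrix are independent, so
  its columns span the whole space, and all columns lie in \<open>V\<close>.\<close>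

lemma reachable_invariant_subspace:
  fixes A :: "complex^'n^'n" and B :: "complex^'m^'n"
  assumes r: "reachable A B" and V: "vec.subspace V"
    and BV: "\<And>u. B *v u \<in> V" and AV: "\<And>x. x \<in> V \<Longrightarrow> A *v x \<in> V"
  shows "V = UNIV"
proof -
  let ?R = "reachability_matrix A B"
  have dim: "vec.dim (rows ?R) = CARD('n)"
    using r by (simp add: reachable_def row_rank_def_gen)
  define \<rho> where "\<rho> i = row i ?R" for i
  have rows: "rows ?R = range \<rho>" by (auto simp: rows_def \<rho>_def)
  have fin: "finite (rows ?R)" by (simp add: rows)
  have "card (rows ?R) \<le> CARD('n)" unfolding rows by (rule card_image_le) simp
  moreover have "CARD('n) \<le> card (rows ?R)"
    using vec.dim_le_card[OF vec.span_superset fin] dim by simp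
  ultimately have card: "card (rows ?R) = CARD('n)" by simp
  then have inj: "inj \<rho>"
    unfolding rows by (intro eq_card_imp_inj_on) auto
  have ind: "vec.independent (rows ?R)"
    by (rule vec.card_le_dim_spanning[OF subset_refl vec.span_superset fin]) (use card dim in simp)
  have "\<exists>C. ?R ** C = mat 1"
    unfolding matrix_right_invertible_independent_rows
  proof (intro allI impI)
    fix c i assume 0: "(\<Sum>i\<in>UNIV. c i *s row i ?R) = 0"
    have "(\<Sum>v\<in>rows ?R. c (inv \<rho> v) *s v) = 0"
      unfolding rows using 0 inj by (simp add: sum.reindex \<rho>_def[symmetric])
    moreover have "\<forall>d. (\<Sum>v\<in>rows ?R. d v *s v) = 0 \<longrightarrow> (\<forall>v\<in>rows ?R. d v = 0)"
      using ind by (simp add: vec.independent_explicit)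
    ultimately have "\<forall>v\<in>rows ?R. c (inv \<rho> v) = 0" by (meson spec mp)
    then have "c (inv \<rho> (\<rho> i)) = 0" by (simp add: rows)
    then show "c i = 0" using inj by (simp add: inv_f_f)
  qed
  then have sp: "vec.span (columns ?R) = UNIV"
    by (simp add: matrix_right_invertible_span_columns)
  have "column kj ?R \<in> V" for kj
  proof -
    have "(((**) A ^^ k) B) *v u \<in> V" for k u
      by (induction k) (simp_all add: BV AV matrix_vector_mul_assoc[symmetric])
    moreover have "column kj ?R = (((**) A ^^ to_nat_on UNIV (fst kj)) B) *v axis (snd kj) 1"
      by (simp add: column_def reachability_matrix_def matrix_vector_mult_basis
         vec_eq_iff matrix_vector_mult_def axis_def if_distrib cong: if_cong)
    ultimately show ?thesis by simp
  qed
  then have "columns ?R \<subseteq> V" by (auto simp: columns_def)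
  then have "vec.span (columns ?R) \<subseteq> V" using V by (rule vec.span_minimal)
  then show ?thesis unfolding sp by (rule top.extremum_uniqueI)
qed

text \<open>As long as the trajectory spans a proper subspace \<open>V\<close>, some input leads out of it. Otherwise
  the zero input gives that \<open>A\<close> maps the current state into \<open>V\<close>, so that \<open>V\<close> contains the range of
  \<open>B\<close>; then \<open>A\<close> maps also the earlier states into \<open>V\<close>, because each successor differs from that image
  only by an element of the range. This contradicts reachability.\<close>

lemma reachable_independent_trajectory:
  fixes A :: "complex^'n^'n" and B :: "complex^'m^'n"
  assumes r: "reachable A B" and b: "B *v v \<noteq> 0" and k: "k < CARD('n)"
  shows "\<exists>x u. x 0 = B *v v \<and> (\<forall>i<k. x (Suc i) = A *v x i + B *v u i) \<and>
      inj_on x {..k} \<and> vec.independent (x ` {..k})"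
  using k
proof (induction k)
  case 0
  show ?case using b by (intro exI[of _ "\<lambda>_. B *v v"]) auto
next
  case (Suc k)
  then obtain x u where x: "x 0 = B *v v" "\<And>i. i < k \<Longrightarrow> x (Suc i) = A *v x i + B *v u i"
    "inj_on x {..k}" "vec.independent (x ` {..k})" by auto
  define V where "V = vec.span (x ` {..k})"
  have inV: "x i \<in> V" if "i \<le> k" for i
    unfolding V_def using that by (intro vec.span_base) auto
  have sV: "vec.subspace V" by (simp add: V_def)
  have "vec.dim V = Suc k"
    unfolding V_def vec.dim_span vec.dim_eq_card_independent[OF x(4)] card_image[OF x(3)] by simp
  then have "V \<noteq> UNIV" using Suc.prems by (auto simp: card_cart_basis)
  have "\<exists>u0. A *v x k + B *v u0 \<notin> V"
  proof (rule ccontr)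
    assume "\<nexists>u0. A *v x k + B *v u0 \<notin> V"
    then have all: "A *v x k + B *v u0 \<in> V" for u0 by blast
    have Ak: "A *v x k \<in> V" using all[of 0] by simp
    have BV: "B *v u0 \<in> V" for u0
      using vec.subspace_diff[OF sV all[of u0] Ak] by simp
    have Ai: "A *v x i \<in> V" if "i \<le> k" for i
    proof (cases "i = k")
      case False
      with that have "i < k" by simp
      then have "A *v x i = x (Suc i) - B *v u i" using x(2) by simp
      then show ?thesis using vec.subspace_diff[OF sV inV BV] \<open>i < k\<close> by simp
    qed (use Ak in simp)
    have "A *v y \<in> V" if "y \<in> V" for y
    proof -
      have "y \<in> vec.span (x ` {..k})" using that by (simp add: V_def)
      then show ?thesis
      proof (induction rule: vec.span_induct_alt)
        case base
        then show ?case using vec.subspace_0[OF sV] by simp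
      next
        case (step c a y)
        then show ?case
          using Ai by (auto simp: matrix_vector_right_distrib vector_scalar_commute
              intro!: vec.subspace_add[OF sV] vec.subspace_scale[OF sV])
      qed
    qed
    then have "V = UNIV" by (intro reachable_invariant_subspace[OF r sV BV])
    with \<open>V \<noteq> UNIV\<close> show False ..
  qed
  then obtain u0 where u0: "A *v x k + B *v u0 \<notin> V" by blast
  define x' where "x' = x(Suc k := A *v x k + B *v u0)"
  define u' where "u' = u(k := u0)"
  have im: "x' ` {..k} = x ` {..k}" by (auto simp: x'_def)
  have "x' 0 = B *v v" using x by (simp add: x'_def)
  moreover have "x' (Suc i) = A *v x' i + B *v u' i" if "i < Suc k" for i
    using that x(2) by (auto simp: x'_def u'_def less_Suc_eq)
  moreover have "inj_on x' {..Suc k}"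
  proof -
    have "inj_on x' {..k}" using x(3) by (auto simp: inj_on_def x'_def)
    moreover have "x' (Suc k) \<notin> x' ` {..k}"
      using u0 inV unfolding im by (auto simp: x'_def)
    ultimately show ?thesis by (simp add: atMost_Suc)
  qed
  moreover have "vec.independent (x' ` {..Suc k})"
    using u0 x(4) by (simp add: atMost_Suc im vec.independent_insert V_def) (simp add: x'_def)
  ultimately show ?case by blast
qed

text \<open>Heymann's lemma: the inputs along an independent trajectory of full length can be generated by a
  linear state feedback, since the states form a basis, and the trajectory then consists of the Krylov
  vectors of the closed loop.\<close>

lemma heymann:
  fixes A :: "complex^'n^'n" and B :: "complex^'m^'n"
  assumes r: "reachable A B" and b: "B *v v \<noteq> 0"
  shows "\<exists>F. invertible (krylov_matrix (A + B ** F) (B *v v))"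
proof -
  define k where "k = CARD('n) - 1"
  have k: "k < CARD('n)" "Suc k = CARD('n)" by (auto simp: k_def)
  obtain x u where x: "x 0 = B *v v" "\<And>i. i < k \<Longrightarrow> x (Suc i) = A *v x i + B *v u i"
    "inj_on x {..k}" "vec.independent (x ` {..k})"
    using reachable_independent_trajectory[OF r b k(1)] by blast
  obtain g where g: "Vector_Spaces.linear (*s) (*s) g" "\<And>y. y \<in> x ` {..k} \<Longrightarrow> g y = u (inv_into {..k} x y)"
    using vec.linear_independent_extend[OF x(4), of "\<lambda>y. u (inv_into {..k} x y)"] by blast
  define F where "F = matrix g"
  have F: "F *v x i = u i" if "i \<le> k" for i
    using g x(3) that unfolding F_def by simp
  have iter: "((*v) (A + B ** F) ^^ i) (B *v v) = x i" if "i \<le> k" for i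
    using that
  proof (induction i)
    case (Suc i)
    then show ?case
      using F[of i] x(2)[of i]
      by (simp add: matrix_vector_mult_add_rdistrib matrix_vector_mul_assoc[symmetric])
  qed (use x in simp)
  let ?K = "krylov_matrix (A + B ** F) (B *v v)"
  have "x ` {..k} \<subseteq> columns ?K"
  proof clarify
    fix i assume "i \<le> k"
    then have "i < CARD('n)" using k by simp
    then obtain j :: 'n where "to_nat_on UNIV j = i" by (rule to_nat_on_UNIV_surj)
    then have "column j ?K = x i" using iter \<open>i \<le> k\<close> by (simp add: column_def krylov_matrix_def)
    then show "x i \<in> columns ?K" unfolding columns_def by (metis (mono_tags, lifting) UNIV_I mem_Collect_eq)
  qed
  moreover have "vec.span (x ` {..k}) = UNIV"
    using vec.card_ge_dim_independent[OF subset_UNIV x(4)] card_image[OF x(3)] k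
    by (auto simp: card_cart_basis)
  ultimately have "vec.span (columns ?K) = UNIV"
    using vec.span_mono by blast
  then have "invertible ?K"
    by (simp add: invertible_right_inverse matrix_right_invertible_span_columns)
  then show ?thesis by blast
qed

section \<open>The set of feedbacks making a pair cyclic\<close>

text \<open>Polynomial dependence of a scalar function on \<open>z\<close> is expressed as membership in \<open>range poly\<close>, so
  that the closure properties below decide it by structural decomposition of the term.\<close>

lemma poly_range_add: "f \<in> range poly \<Longrightarrow> g \<in> range poly \<Longrightarrow> (\<lambda>z. f z + g z) \<in> range poly"
  for f :: "'a::comm_ring_1 \<Rightarrow> 'a"
  by (auto simp: image_iff fun_eq_iff simp flip: poly_add)

lemma poly_range_mult: "f \<in> range poly \<Longrightarrow> g \<in> range poly \<Longrightarrow> (\<lambda>z. f z * g z) \<in> range poly"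
  for f :: "'a::comm_ring_1 \<Rightarrow> 'a"
  by (auto simp: image_iff fun_eq_iff simp flip: poly_mult)

lemma poly_range_const: "(\<lambda>_. c) \<in> range poly" for c :: "'a::comm_ring_1"
  by (auto simp: image_iff fun_eq_iff intro!: exI[of _ "[:c:]"])

lemma poly_range_id: "(\<lambda>z::'a. z) \<in> range (poly :: 'a::comm_ring_1 poly \<Rightarrow> _)"
  by (rule image_eqI[of _ _ "[:0, 1:]"]) (auto simp: fun_eq_iff)

lemma poly_range_sum: "(\<And>i. i \<in> S \<Longrightarrow> f i \<in> range poly) \<Longrightarrow> (\<lambda>z. \<Sum>i\<in>S. f i z) \<in> range poly"
  for f :: "'i \<Rightarrow> 'a::comm_ring_1 \<Rightarrow> 'a"
  by (induction S rule: infinite_finite_induct) (simp_all add: poly_range_const poly_range_add)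

lemma poly_range_prod: "(\<And>i. i \<in> S \<Longrightarrow> f i \<in> range poly) \<Longrightarrow> (\<lambda>z. \<Prod>i\<in>S. f i z) \<in> range poly"
  for f :: "'i \<Rightarrow> 'a::comm_ring_1 \<Rightarrow> 'a"
  by (induction S rule: infinite_finite_induct) (simp_all add: poly_range_const poly_range_mult)

lemmas poly_range_intros =
  poly_range_add poly_range_mult poly_range_const poly_range_id poly_range_sum poly_range_prod

text \<open>Two points of the set span a complex line, on which the function is a nonzero polynomial of one
  variable. The complex plane without the finitely many zeros is path connected.\<close>

lemma path_connected_poly_nonzero:
  fixes p :: "complex^'n^'m \<Rightarrow> complex"
  assumes poly: "\<And>F G. (\<lambda>z. p (F + (\<chi> i j. z * G $ i $ j))) \<in> range poly"
  shows "path_connected {F. p F \<noteq> 0}"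
  unfolding path_connected_def
proof (intro ballI)
  fix F G assume "F \<in> {F. p F \<noteq> 0}" "G \<in> {F. p F \<noteq> 0}"
  define L where "L z = F + (\<chi> i j. z * (G - F) $ i $ j)" for z
  have L01: "L 0 = F" "L 1 = G" by (simp_all add: L_def vec_eq_iff)
  obtain q where q: "\<And>z. p (L z) = poly q z"
    using poly[of F "G - F"] by (auto simp: L_def fun_eq_iff)
  have "poly q 0 \<noteq> 0" "poly q 1 \<noteq> 0"
    using \<open>F \<in> _\<close> \<open>G \<in> _\<close> by (simp_all flip: q add: L01)
  then have "q \<noteq> 0" by auto
  then have "path_connected (- {z. poly q z = 0})"
    by (intro path_connected_complement_countable countable_finite poly_roots_finite) auto
  then obtain g where g: "path g" "path_image g \<subseteq> - {z. poly q z = 0}" "pathstart g = 0" "pathfinish g = 1"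
    using \<open>poly q 0 \<noteq> 0\<close> \<open>poly q 1 \<noteq> 0\<close> unfolding path_connected_def by fastforce
  have "continuous_on (path_image g) L"
    unfolding L_def by (intro continuous_intros)
  then have "path (L \<circ> g)" using g(1) by (rule path_continuous_image[rotated])
  moreover have "path_image (L \<circ> g) \<subseteq> {F. p F \<noteq> 0}"
    using g(2) by (auto simp: path_image_compose q)
  ultimately show "\<exists>g. path g \<and> path_image g \<subseteq> {F. p F \<noteq> 0} \<and> pathstart g = F \<and> pathfinish g = G"
    using g L01 by (intro exI[of _ "L \<circ> g"]) (auto simp: pathstart_compose pathfinish_compose)
qed

lemma path_connected_cyclic_feedbacks:
  fixes A :: "complex^'n^'n" and B :: "complex^'m^'n"
  shows "path_connected {F. det (krylov_matrix (A + B ** F) b) \<noteq> 0}"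
proof (rule path_connected_poly_nonzero)
  fix F G :: "complex^'n^'m"
  let ?M = "\<lambda>z. A + B ** (F + (\<chi> i j. z * G $ i $ j))"
  have "(\<lambda>z. (((*v) (?M z) ^^ k) b) $ i) \<in> range poly" for k i
  proof (induction k arbitrary: i)
    case (Suc k)
    then show ?case
      by (simp add: matrix_vector_mult_def matrix_matrix_mult_def) (intro poly_range_intros)
  qed (simp add: poly_range_const)
  then show "(\<lambda>z. det (krylov_matrix (?M z) b)) \<in> range poly"
    unfolding det_def krylov_matrix_def by (simp, intro poly_range_intros)
qed

section \<open>Continuity of matrix operations\<close>

lemma continuous_on_matrix_mult [continuous_intros]:
  fixes A :: "'x::topological_space \<Rightarrow> complex^'n^'m" and B :: "'x \<Rightarrow> complex^'k^'n"
  shows "continuous_on S A \<Longrightarrow> continuous_on S B \<Longrightarrow> continuous_on S (\<lambda>x. A x ** B x)"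
  unfolding matrix_matrix_mult_def by (intro continuous_intros)

lemma continuous_on_matrix_vector_mult [continuous_intros]:
  fixes A :: "'x::topological_space \<Rightarrow> complex^'n^'m" and f :: "'x \<Rightarrow> complex^'n"
  shows "continuous_on S A \<Longrightarrow> continuous_on S f \<Longrightarrow> continuous_on S (\<lambda>x. A x *v f x)"
  unfolding matrix_vector_mult_def by (intro continuous_intros)

lemma continuous_on_vector_matrix_mult [continuous_intros]:
  fixes A :: "'x::topological_space \<Rightarrow> complex^'n^'m" and f :: "'x \<Rightarrow> complex^'m"
  shows "continuous_on S A \<Longrightarrow> continuous_on S f \<Longrightarrow> continuous_on S (\<lambda>x. f x v* A x)"
  unfolding vector_matrix_mult_def by (intro continuous_intros)

lemma continuous_on_outer [continuous_intros]:
  fixes b :: "'x::topological_space \<Rightarrow> complex^'n" and k :: "'x \<Rightarrow> complex^'m"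
  shows "continuous_on S b \<Longrightarrow> continuous_on S k \<Longrightarrow> continuous_on S (\<lambda>x. outer (b x) (k x))"
  unfolding outer_def by (intro continuous_intros)

lemma continuous_on_det [continuous_intros]:
  fixes A :: "'x::topological_space \<Rightarrow> complex^'n^'n"
  shows "continuous_on S A \<Longrightarrow> continuous_on S (\<lambda>x. det (A x))"
  unfolding det_def by (intro continuous_intros)

lemma continuous_on_krylov_matrix [continuous_intros]:
  fixes A :: "'x::topological_space \<Rightarrow> complex^'n^'n" and b :: "'x \<Rightarrow> complex^'n"
  assumes "continuous_on S A" "continuous_on S b"
  shows "continuous_on S (\<lambda>x. krylov_matrix (A x) (b x))"
proof -
  have "continuous_on S (\<lambda>x. ((*v) (A x) ^^ k) (b x))" for k
    by (induction k) (auto intro!: continuous_intros assms)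
  then show ?thesis
    unfolding krylov_matrix_def by (intro continuous_intros)
qed

lemma continuous_on_shifted_product [continuous_intros]:
  fixes A :: "'x::topological_space \<Rightarrow> complex^'n^'n"
  assumes "continuous_on S A" "\<And>j. continuous_on S (\<lambda>x. l x j)"
  shows "continuous_on S (\<lambda>x. shifted_product (A x) (l x) k)"
proof -
  have "continuous_on S (\<lambda>x. mat (l x j) :: complex^'n^'n)" for j
    unfolding mat_def
  proof (intro continuous_on_vec_lambda)
    show "continuous_on S (\<lambda>x. if i = k then l x j else 0)" for i k :: 'n
      using assms by (cases "i = k") auto
  qed
  then show ?thesis
    by (induction k) (auto intro!: continuous_intros assms)
qed

text \<open>Cramer's rule, applied to the columns of the identity matrix, expresses the inverse by determinants.\<close>

lemma continuous_matrix_inverse: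
  fixes A :: "'x::topological_space \<Rightarrow> complex^'n^'n"
  assumes A: "continuous_on S A" and inv: "\<forall>x\<in>S. invertible (A x)"
  shows "\<exists>N. continuous_on S N \<and> (\<forall>x\<in>S. A x ** N x = mat 1 \<and> N x ** A x = mat 1)"
proof -
  define R where "R x c k = (\<chi> i j. if j = k then mat 1 $ i $ c else A x $ i $ j)" for x and c k :: 'n
  define N where "N x = (\<chi> k c. det (R x c k) / det (A x))" for x
  have AN: "A x ** N x = mat 1" if "x \<in> S" for x
  proof -
    have d: "det (A x) \<noteq> 0" using inv that by (simp add: invertible_det_nz)
    have "(A x ** N x) $ i $ c = mat 1 $ i $ c" for i c
    proof -
      have "A x *v (\<chi> k. det (R x c k) / det (A x)) = (\<chi> i. mat 1 $ i $ c)"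
        unfolding cramer[OF d] by (simp add: R_def cong: if_cong)
      then show ?thesis
        by (simp add: N_def vec_eq_iff matrix_vector_mult_def matrix_matrix_mult_def)
    qed
    then show ?thesis by (simp add: vec_eq_iff)
  qed
  have "continuous_on S (\<lambda>x. R x c k)" for c k
    unfolding R_def
  proof (intro continuous_on_vec_lambda)
    show "continuous_on S (\<lambda>x. if j = k then mat 1 $ i $ c else A x $ i $ j)" for i j
      using A by (cases "j = k") (auto intro!: continuous_intros)
  qed
  then have "continuous_on S N"
    unfolding N_def using inv by (intro continuous_intros A) (auto simp: invertible_det_nz)
  then show ?thesis
    using AN matrix_left_right_inverse by (intro exI[of _ N]) blast
qed

section \<open>The spectrum of a multiplication operator\<close>

lemma norm_matrix_vector_mult_le:
  fixes N :: "complex^'n^'m"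
  shows "norm (N *v x) \<le> (\<Sum>i\<in>UNIV. \<Sum>j\<in>UNIV. norm (N $ i $ j)) * norm x"
proof -
  have "norm (N *v x) \<le> (\<Sum>i\<in>UNIV. norm ((N *v x) $ i))"
    unfolding norm_vec_def by (rule L2_set_le_sum) simp
  also have "\<dots> \<le> (\<Sum>i\<in>UNIV. \<Sum>j\<in>UNIV. norm (N $ i $ j) * norm x)"
  proof (rule sum_mono)
    fix i
    have "norm ((N *v x) $ i) \<le> (\<Sum>j\<in>UNIV. norm (N $ i $ j * x $ j))"
      by (simp add: matrix_vector_mult_def norm_sum)
    also have "\<dots> \<le> (\<Sum>j\<in>UNIV. norm (N $ i $ j) * norm x)"
      by (intro sum_mono) (simp add: norm_mult mult_left_mono Finite_Cartesian_Product.norm_nth_le)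
    finally show "norm ((N *v x) $ i) \<le> (\<Sum>j\<in>UNIV. norm (N $ i $ j) * norm x)" .
  qed
  finally show ?thesis by (simp add: sum_distrib_right)
qed

lemma bounded_operator_mult_operator:
  fixes N :: "complex \<Rightarrow> complex^'n^'n"
  assumes P: "compact P" "P \<noteq> {}" and N: "continuous_on P N"
  shows "bounded_operator P (mult_operator N)"
proof -
  have mem: "mult_operator N f \<in> cont_space P" if "f \<in> cont_space P" for f
    using that N by (auto simp: cont_space_def mult_operator_def intro!: continuous_intros)
  define c where "c t = (\<Sum>i\<in>UNIV. \<Sum>j\<in>UNIV. norm (N t $ i $ j))" for t
  have "continuous_on P c" unfolding c_def by (intro continuous_intros N)
  then have "bounded (c ` P)" using P by (intro compact_imp_bounded compact_continuous_image)
  then obtain K where K: "\<And>t. t \<in> P \<Longrightarrow> c t \<le> K"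
    by (auto simp: bounded_iff) (meson abs_le_D1)
  have "sup_norm P (mult_operator N f) \<le> K * sup_norm P f" if f: "f \<in> cont_space P" for f
    unfolding sup_norm_def
  proof (rule cSUP_least[OF P(2)])
    fix t assume t: "t \<in> P"
    have "continuous_on P (\<lambda>t. norm (f t))"
      using f by (intro continuous_intros) (simp add: cont_space_def)
    then have bdd: "bdd_above ((\<lambda>t. norm (f t)) ` P)"
      using P by (intro bounded_imp_bdd_above compact_imp_bounded compact_continuous_image)
    have "0 \<le> c t" by (auto simp: c_def intro!: sum_nonneg)
    then have "0 \<le> K" using K[OF t] by simp
    have "norm (mult_operator N f t) \<le> c t * norm (f t)"
      unfolding mult_operator_def c_def by (rule norm_matrix_vector_mult_le)
    also have "\<dots> \<le> K * (SUP t\<in>P. norm (f t))"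
      using K[OF t] \<open>0 \<le> K\<close> cSUP_upper[OF t bdd] by (intro mult_mono) auto
    finally show "norm (mult_operator N f t) \<le> K * (SUP t\<in>P. norm (f t))" .
  qed
  then show ?thesis
    unfolding bounded_operator_def using mem
    by (auto simp: mult_operator_def matrix_vector_right_distrib vector_scalar_commute fun_eq_iff)
qed

text \<open>If \<open>z - M t\<close> is invertible for all \<open>t\<close>, then its inverse is continuous and the multiplication by
  it inverts \<open>z\<close> minus the operator. Conversely, an inverse operator applied to the constant functions
  shows that each \<open>z - M t\<close> is surjective, hence invertible.\<close>

lemma op_spectrum_mult_operator:
  fixes M :: "complex \<Rightarrow> complex^'n^'n"
  assumes P: "compact P" "P \<noteq> {}" and M: "continuous_on P M"
  shows "op_spectrum P (mult_operator M) = {z. \<exists>t\<in>P. \<exists>x. x \<noteq> 0 \<and> M t *v x = z *s x}"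
proof (intro set_eqI)
  fix z
  have D: "(mat z - M t) *v x = z *s x - M t *v x" for t x
    by (simp add: matrix_vector_mult_diff_rdistrib mat_mult_vec)
  have inv_iff: "invertible (mat z - M t) \<longleftrightarrow> \<not> (\<exists>x. x \<noteq> 0 \<and> M t *v x = z *s x)" for t
    by (auto simp: invertible_left_inverse matrix_left_invertible_ker D)
  have "(\<exists>S. bounded_operator P S \<and>
     (\<forall>f\<in>cont_space P.
        S (\<lambda>\<theta>. z *s f \<theta> - mult_operator M f \<theta>) = f \<and>
        (\<lambda>\<theta>. z *s S f \<theta> - mult_operator M (S f) \<theta>) = f)) \<longleftrightarrow>
     (\<forall>t\<in>P. invertible (mat z - M t))" (is "?L \<longleftrightarrow> ?R")
  proof
    assume ?L
    then obtain S where S: "\<And>f. f \<in> cont_space P \<Longrightarrow> (\<lambda>\<theta>. z *s S f \<theta> - mult_operator M (S f) \<theta>) = f"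
      by blast
    show ?R
    proof
      fix t assume t: "t \<in> P"
      have "\<exists>x. (mat z - M t) *v x = y" for y
      proof -
        define f where "f = (\<lambda>\<theta>. if \<theta> \<in> P then y else 0)"
        have "f \<in> cont_space P"
          by (auto simp: cont_space_def f_def cong: continuous_on_cong_simp)
        from fun_cong[OF S[OF this], of t] have "(mat z - M t) *v S f t = y"
          using t by (simp add: D mult_operator_def f_def)
        then show ?thesis by blast
      qed
      then show "invertible (mat z - M t)"
        unfolding invertible_right_inverse matrix_right_invertible_surjective surj_def by metis
    qed
  next
    assume R: ?R
    have "continuous_on P (\<lambda>t. mat z - M t)" by (intro continuous_intros M)
    then obtain N where N: "continuous_on P N"
      "\<And>t. t \<in> P \<Longrightarrow> (mat z - M t) ** N t = mat 1" "\<And>t. t \<in> P \<Longrightarrow> N t ** (mat z - M t) = mat 1"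
      using continuous_matrix_inverse[OF _ R] by blast
    have "mult_operator N (\<lambda>\<theta>. z *s f \<theta> - mult_operator M f \<theta>) = f \<and>
        (\<lambda>\<theta>. z *s mult_operator N f \<theta> - mult_operator M (mult_operator N f) \<theta>) = f"
      if f: "f \<in> cont_space P" for f
    proof -
      have "mult_operator N (\<lambda>\<theta>. z *s f \<theta> - mult_operator M f \<theta>) t = f t \<and>
        z *s mult_operator N f t - mult_operator M (mult_operator N f) t = f t" for t
      proof (cases "t \<in> P")
        case True
        have "N t *v ((mat z - M t) *v f t) = f t" "(mat z - M t) *v (N t *v f t) = f t"
          using N(2,3)[OF True] by (simp_all add: matrix_vector_mul_assoc)
        then show ?thesis by (simp add: mult_operator_def D)
      next
        case False
        then show ?thesis using f by (simp add: mult_operator_def cont_space_def)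
      qed
      then show ?thesis by auto
    qed
    then show ?L using bounded_operator_mult_operator[OF P N(1)] by blast
  qed
  then show "z \<in> op_spectrum P (mult_operator M) \<longleftrightarrow> z \<in> {z. \<exists>t\<in>P. \<exists>x. x \<noteq> 0 \<and> M t *v x = z *s x}"
    unfolding op_spectrum_def inv_iff by blast
qed

section \<open>Pole placement by continuous feedback\<close>

lemma continuous_cyclic_feedback:
  fixes A :: "complex \<Rightarrow> complex^'n^'n" and B :: "complex \<Rightarrow> complex^'m^'n"
  assumes P: "is_compact_interval P \<or> is_circle P"
    and A: "continuous_on P A" and B: "continuous_on P B"
    and r: "pointwise_reachable P A B"
    and v: "\<forall>\<theta>\<in>P. B \<theta> *v v \<noteq> 0"
  shows "\<exists>F. continuous_on P F \<and>
    (\<forall>\<theta>\<in>P. invertible (krylov_matrix (A \<theta> + B \<theta> ** F \<theta>) (B \<theta> *v v)))"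
proof -
  define d where "d \<theta> F = det (krylov_matrix (A \<theta> + B \<theta> ** F) (B \<theta> *v v))" for \<theta> F
  define W where "W \<theta> = {F. d \<theta> F \<noteq> 0}" for \<theta>
  have AB: "continuous_on (P \<times> UNIV) (\<lambda>z::complex \<times> (complex^'n^'m). A (fst z))"
    "continuous_on (P \<times> UNIV) (\<lambda>z::complex \<times> (complex^'n^'m). B (fst z))"
    by (auto intro!: continuous_intros continuous_on_compose2[OF A] continuous_on_compose2[OF B])
  have "continuous_on (P \<times> UNIV) (\<lambda>z. d (fst z) (snd z))"
    unfolding d_def by (intro continuous_intros AB)
  then have "openin (top_of_set (P \<times> UNIV)) ((P \<times> UNIV) \<inter> (\<lambda>z. d (fst z) (snd z)) -` (- {0}))"
    by (rule continuous_openin_preimage_gen) auto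
  also have "(P \<times> UNIV) \<inter> (\<lambda>z. d (fst z) (snd z)) -` (- {0}) = Sigma P W"
    by (auto simp: W_def)
  finally have "openin (top_of_set (P \<times> UNIV)) (Sigma P W)" .
  moreover have "\<forall>\<theta>\<in>P. path_connected (W \<theta>)"
    unfolding W_def d_def by (simp add: path_connected_cyclic_feedbacks)
  moreover have "\<forall>\<theta>\<in>P. W \<theta> \<noteq> {}"
  proof
    fix \<theta> assume "\<theta> \<in> P"
    then have "\<exists>F. invertible (krylov_matrix (A \<theta> + B \<theta> ** F) (B \<theta> *v v))"
      using r v by (intro heymann) (auto simp: pointwise_reachable_def)
    then show "W \<theta> \<noteq> {}" by (simp add: W_def d_def invertible_det_nz)
  qed
  ultimately have "\<exists>F. continuous_on P F \<and> (\<forall>\<theta>\<in>P. F \<theta> \<in> W \<theta>)"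
    by (rule section_over_interval_or_circle[OF P])
  then show ?thesis
    by (simp add: W_def d_def invertible_det_nz)
qed

text \<open>The functional in Ackermann's formula is the last row of the inverse of the Krylov matrix, where
  \<open>e\<close> below is the index enumerated last.\<close>

lemma continuous_pole_placement:
  fixes M :: "complex \<Rightarrow> complex^'n^'n" and b :: "complex \<Rightarrow> complex^'n"
  assumes M: "continuous_on P M" and b: "continuous_on P b"
    and l: "\<And>j. continuous_on P (\<lambda>\<theta>. l \<theta> j)"
    and inv: "\<forall>\<theta>\<in>P. invertible (krylov_matrix (M \<theta>) (b \<theta>))"
  shows "\<exists>k. continuous_on P k \<and>
    (\<forall>\<theta>\<in>P. \<forall>z. (\<exists>x. x \<noteq> 0 \<and> (M \<theta> + outer (b \<theta>) (k \<theta>)) *v x = z *s x)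
      \<longleftrightarrow> (\<exists>j<CARD('n). z = l \<theta> j))"
proof -
  obtain N where N: "continuous_on P N" "\<And>\<theta>. \<theta> \<in> P \<Longrightarrow> N \<theta> ** krylov_matrix (M \<theta>) (b \<theta>) = mat 1"
    using continuous_matrix_inverse[OF continuous_on_krylov_matrix[OF M b] inv] by blast
  obtain e :: 'n where e: "to_nat_on UNIV e = CARD('n) - 1"
    using to_nat_on_UNIV_surj[where 'n = 'n, of "CARD('n) - 1"] by auto
  define k where "k \<theta> = - (N \<theta> $ e v* shifted_product (M \<theta>) (l \<theta>) CARD('n))" for \<theta>
  have w: "dot (N \<theta> $ e) (((*v) (M \<theta>) ^^ i) (b \<theta>)) = (if Suc i = CARD('n) then 1 else 0)"
    if "\<theta> \<in> P" "i < CARD('n)" for \<theta> i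
  proof -
    from that(2) obtain c :: 'n where c: "to_nat_on UNIV c = i" by (rule to_nat_on_UNIV_surj)
    have "dot (N \<theta> $ e) (((*v) (M \<theta>) ^^ i) (b \<theta>)) = (N \<theta> ** krylov_matrix (M \<theta>) (b \<theta>)) $ e $ c"
      by (simp add: dot_def matrix_matrix_mult_def krylov_matrix_def c)
    also have "\<dots> = (if e = c then 1 else 0)" by (simp add: N(2)[OF that(1)] mat_def)
    also have "e = c \<longleftrightarrow> to_nat_on UNIV e = to_nat_on UNIV c" by (simp add: countable_finite)
    also have "\<dots> \<longleftrightarrow> Suc i = CARD('n)" using that(2) by (auto simp: e c)
    finally show ?thesis .
  qed
  show ?thesis
  proof (intro exI[of _ k] conjI ballI allI)
    show "continuous_on P k"
      unfolding k_def by (intro continuous_intros N M l)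
    show "(\<exists>x. x \<noteq> 0 \<and> (M \<theta> + outer (b \<theta>) (k \<theta>)) *v x = z *s x) \<longleftrightarrow> (\<exists>j<CARD('n). z = l \<theta> j)"
      if "\<theta> \<in> P" for \<theta> z
      unfolding k_def by (rule eigenvalues_ackermann[OF bspec[OF inv that] w[OF that]])
  qed
qed

theorem theorem4p3:
  fixes P :: "complex set"
    and A :: "complex \<Rightarrow> complex^'n^'n"
    and B :: "complex \<Rightarrow> complex^'m^'n"
    and l :: "'n \<Rightarrow> complex \<Rightarrow> complex"
  assumes "is_compact_interval P \<or> is_circle P"
    and "continuous_on P A"
    and "continuous_on P B"
    and "pointwise_reachable P A B"
    and "\<exists>v :: complex^'m. \<forall>\<theta>\<in>P. B \<theta> *v v \<noteq> 0"
    and "\<And>i. continuous_on P (l i)"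
  shows "\<exists>K :: complex \<Rightarrow> complex^'n^'m. continuous_on P K \<and>
           op_spectrum P (mult_operator (\<lambda>\<theta>. A \<theta> + B \<theta> ** K \<theta>)) =
             (\<Union>\<theta>\<in>P. {l i \<theta> | i. True})"
proof -
  have P: "compact P" "P \<noteq> {}"
    using assms(1) by (auto simp: is_compact_interval_def is_circle_def dest: sym[of "{}"])
  obtain v where v: "\<forall>\<theta>\<in>P. B \<theta> *v v \<noteq> 0" using assms(5) by blast
  obtain F where F: "continuous_on P F"
    "\<forall>\<theta>\<in>P. invertible (krylov_matrix (A \<theta> + B \<theta> ** F \<theta>) (B \<theta> *v v))"
    using continuous_cyclic_feedback[OF assms(1-4) v] by blast
  define l' where "l' \<theta> j = l (inv (to_nat_on UNIV) j) \<theta>" for \<theta> j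
  have "inj (to_nat_on (UNIV :: 'n set))"
    using to_nat_on_finite[of "UNIV :: 'n set"] by (simp add: bij_betw_def)
  then have l'_nat: "l' \<theta> (to_nat_on UNIV i) = l i \<theta>" for \<theta> i by (simp add: l'_def)
  have l': "(\<exists>j<CARD('n). z = l' \<theta> j) \<longleftrightarrow> (\<exists>i. z = l i \<theta>)" for z \<theta>
    using l'_nat to_nat_on_UNIV_less unfolding l'_def by metis
  have M: "continuous_on P (\<lambda>\<theta>. A \<theta> + B \<theta> ** F \<theta>)" and b: "continuous_on P (\<lambda>\<theta>. B \<theta> *v v)"
    by (intro continuous_intros assms F)+
  have cl: "continuous_on P (\<lambda>\<theta>. l' \<theta> j)" for j
    unfolding l'_def by (rule assms)
  obtain k where k: "continuous_on P k"
    "\<And>\<theta> z. \<theta> \<in> P \<Longrightarrow> (\<exists>x. x \<noteq> 0 \<and> (A \<theta> + B \<theta> ** F \<theta> + outer (B \<theta> *v v) (k \<theta>)) *v x = z *s x)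
      \<longleftrightarrow> (\<exists>j<CARD('n). z = l' \<theta> j)"
    using continuous_pole_placement[where l = l', OF M b cl F(2)] by blast
  define K where "K \<theta> = F \<theta> + outer v (k \<theta>)" for \<theta>
  have K: "continuous_on P K" unfolding K_def by (intro continuous_intros F k)
  have "B \<theta> ** outer v (k \<theta>) = outer (B \<theta> *v v) (k \<theta>)" for \<theta>
    by (simp add: vec_eq_iff outer_def matrix_matrix_mult_def matrix_vector_mult_def
        sum_distrib_right mult.assoc)
  then have ABK: "A \<theta> + B \<theta> ** K \<theta> = A \<theta> + B \<theta> ** F \<theta> + outer (B \<theta> *v v) (k \<theta>)" for \<theta>
    by (simp add: K_def matrix_add_ldistrib)
  have "continuous_on P (\<lambda>\<theta>. A \<theta> + B \<theta> ** K \<theta>)" by (intro continuous_intros assms K)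
  from op_spectrum_mult_operator[OF P this]
  have "op_spectrum P (mult_operator (\<lambda>\<theta>. A \<theta> + B \<theta> ** K \<theta>)) = (\<Union>\<theta>\<in>P. {l i \<theta> | i. True})"
    by (auto simp: ABK k(2) l')
  with K show ?thesis by blast
qed

end
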